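(* The $P_2$ set $\{7,14,41\}$ is non-extendable; that is, there is no positive integer $m\notin\{7,14,41\}$ such that $\{7,14,41,m\}$ is a $P_2$ set.
   Context: Let $n$ be an integer. A set $\{a_1,\dots,a_r\}$ of $r$ distinct positive integers has the property $D(n)$, and is called a $P_n$ set of size $r$ (or a Diophantine $r$-tuple with the property $D(n)$), if $a_ia_j+n$ is a perfect square (the square of an integer) for all $1\le i<j\le r$. A $P_n$ set of size 3 is called non-extendable if it cannot be enlarged to a $P_n$ set of size 4 (a Diophantine quadruple with the property $D(n)$) by adjoining a further positive integer distinct from its elements. *)

theory Defs
  imports "HOL-Computational_Algebra.Nth_Powers"
begin


definition P_set :: "int \<Rightarrow> nat \<Rightarrow> int set \<Rightarrow> bool" where
  "P_set n r A \<longleftrightarrow>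
     finite A \<and> card A = r \<and> (\<forall>a\<in>A. a > 0) \<and>
     (\<forall>a\<in>A. \<forall>b\<in>A. a \<noteq> b \<longrightarrow> is_square (a * b + n))"

definition non_extendable :: "int \<Rightarrow> int set \<Rightarrow> bool" where
  "non_extendable n A \<longleftrightarrow>
     P_set n 3 A \<and> \<not> (\<exists>m. m > 0 \<and> m \<notin> A \<and> P_set n 4 (insert m A))"

end

theory Submission
  imports Defs
begin

text \<open>
  The obstruction to extending the triple is local at 4. Since \<open>7\<close>, \<open>14\<close>, \<open>41\<close> are congruent to
  \<open>3\<close>, \<open>2\<close>, \<open>1\<close> modulo 4, for each residue of \<open>m\<close> one of \<open>7 * m + 2\<close>, \<open>14 * m + 2\<close>, \<open>41 * m + 2\<close>
  is congruent to 2 or 3, and so is not a square: for even \<open>m\<close> it is \<open>14 * m + 2\<close>,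
  for \<open>m \<equiv> 1\<close> it is \<open>41 * m + 2\<close>, and for \<open>m \<equiv> 3\<close> it is \<open>7 * m + 2\<close>.
\<close>

lemma is_square_int_mod_4:
  fixes x :: int
  assumes "is_square x"
  shows "x mod 4 = 0 \<or> x mod 4 = 1"
proof -
  obtain y where y: "x = y ^ 2"
    using assms by (auto elim: is_nth_powerE)
  show ?thesis
  proof (cases "even y")
    case True
    then obtain k where "y = 2 * k" by (rule evenE)
    then have "x = 4 * k ^ 2" by (simp add: y power_mult_distrib)
    then show ?thesis by simp
  next
    case False
    then obtain k where "y = 2 * k + 1" by (rule oddE)
    then have "x = 4 * (k ^ 2 + k) + 1" by (simp add: y power2_eq_square algebra_simps)
    then show ?thesis by presburger
  qed
qed

lemma not_all_squares_7_14_41: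
  fixes m :: int
  assumes "is_square (7 * m + 2)" "is_square (14 * m + 2)" "is_square (41 * m + 2)"
  shows False
proof -
  have no_square: "\<not> is_square (4 * k + 2)" "\<not> is_square (4 * k + 3)" for k :: int
    using is_square_int_mod_4[of "4 * k + 2"] is_square_int_mod_4[of "4 * k + 3"]
      mod_mult_self4[of 4 k 2] mod_mult_self4[of 4 k 3] by auto
  have "even m \<or> m mod 4 = 1 \<or> m mod 4 = 3"
    by presburger
  then consider k where "m = 2 * k" | k where "m = 4 * k + 1" | k where "m = 4 * k + 3"
    by (metis evenE mult_div_mod_eq)
  then show False
  proof cases
    case (1 k)
    then have "14 * m + 2 = 4 * (7 * k) + 2" by simp
    with assms(2) no_square(1) show False by metis
  next
    case (2 k)
    then have "41 * m + 2 = 4 * (41 * k + 10) + 3" by simp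
    with assms(3) no_square(2) show False by metis
  next
    case (3 k)
    then have "7 * m + 2 = 4 * (7 * k + 5) + 3" by simp
    with assms(1) no_square(2) show False by metis
  qed
qed

lemma P_set_insertD:
  assumes "P_set n r (insert m A)" "m \<notin> A" "a \<in> A"
  shows "is_square (a * m + n)"
proof -
  have "\<forall>a\<in>insert m A. \<forall>b\<in>insert m A. a \<noteq> b \<longrightarrow> is_square (a * b + n)"
    using assms(1) unfolding P_set_def by (elim conjE)
  moreover have "a \<in> insert m A" "m \<in> insert m A" "a \<noteq> m"
    using assms(2,3) by auto
  ultimately show ?thesis by metis
qed

lemma P_set_2_7_14_41: "P_set 2 3 {7, 14, 41}"
proof -
  have "is_square (100 :: int)" "is_square (289 :: int)" "is_square (576 :: int)"
    using is_nth_power_nth_power[of 2 "10 :: int"] is_nth_power_nth_power[of 2 "17 :: int"]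
      is_nth_power_nth_power[of 2 "24 :: int"] by simp_all
  then show ?thesis by (simp add: P_set_def)
qed

theorem theorem2: "non_extendable 2 {7, 14, 41}"
proof -
  have "\<not> P_set 2 4 (insert m {7, 14, 41})" if "m \<notin> {7, 14, 41}" for m
  proof
    assume "P_set 2 4 (insert m {7, 14, 41})"
    note square = P_set_insertD[OF this that]
    show False
      by (rule not_all_squares_7_14_41[of m]) (rule square, simp)+
  qed
  with P_set_2_7_14_41 show ?thesis
    unfolding non_extendable_def by blast
qed

end
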